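(* Let $\mathcal{H}$ be a real Hilbert space and $q\in\mathcal{H}$. Let $A\colon\mathcal{H}\rightrightarrows\mathcal{H}$ be maximally $\alpha_A$-monotone, and let $B\colon\mathcal{H}\to\mathcal{H}$ be $\alpha_B$-monotone and $\kappa$-Lipschitz continuous, where $\alpha_A,\alpha_B\in\mathbb{R}$ and $\kappa>0$. Let $\theta,\sigma_A,\sigma_B>0$ be such that $\theta\alpha_A+\sigma_A>0$ and $\theta\alpha_B+\sigma_B>0$, and let $\gamma\in\left]0,\frac{1}{\theta\kappa+\sigma_B}\right[$. For any initial point $x_0\in\mathcal{H}$, consider the sequence $(x_k)$ given, for $k\in\mathbb{N}$, by $$\left\{\begin{aligned} y_k&=J_{\frac{\gamma\theta}{1+\gamma\sigma_A}A}\left(\frac{1}{1+\gamma\sigma_A}\bigl((1-\gamma\sigma_B)x_k-\gamma\theta B(x_k)+\gamma(\sigma_A+\sigma_B)q\bigr)\right)\\ x_{k+1}&=(1-\gamma\sigma_B)y_k+\gamma\sigma_Bx_k-\gamma\theta B(y_k)+\gamma\theta B(x_k).\end{aligned}\right.$$ Then $(x_k)$ converges linearly to $J_{\frac{\theta}{\sigma_A+\sigma_B}(A+B)}(q)$.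
   Context: For $\alpha\in\mathbb{R}$, a set-valued operator $A\colon\mathcal{H}\rightrightarrows\mathcal{H}$ is $\alpha$-monotone if $\langle x-y,u-v\rangle\ge\alpha\|x-y\|^2$ for all $(x,u),(y,v)$ in its graph, and maximally $\alpha$-monotone if moreover no $\alpha$-monotone operator has a graph properly containing that of $A$. The resolvent of $A$ with parameter $\gamma>0$ is $J_{\gamma A}:=(\mathrm{Id}+\gamma A)^{-1}$ (a singleton $\{u\}$ is identified with $u$). A sequence $(x_k)$ converges linearly to $x$ if $\limsup_{k\to\infty}\frac{\|x_{k+1}-x\|}{\|x_k-x\|}<1$. *)

theory Defs
  imports "HOL-Analysis.Analysis" "HOL-Library.Set_Algebras"
begin

text \<open>A set-valued operator on a space is a function into sets; a single-valued map \<open>B\<close> is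
  embedded as \<open>\<lambda>x. {B x}\<close>.\<close>

definition op_graph :: "('a \<Rightarrow> 'a set) \<Rightarrow> ('a \<times> 'a) set" where
  "op_graph A = {(x, u). u \<in> A x}"

definition op_add :: "('a::plus \<Rightarrow> 'a set) \<Rightarrow> ('a \<Rightarrow> 'a set) \<Rightarrow> 'a \<Rightarrow> 'a set" where
  "op_add A B = (\<lambda>x. A x + B x)"

definition op_scale :: "real \<Rightarrow> ('a::real_vector \<Rightarrow> 'a set) \<Rightarrow> 'a \<Rightarrow> 'a set" where
  "op_scale c A = (\<lambda>x. (\<lambda>u. c *\<^sub>R u) ` A x)"

definition op_inverse :: "('a \<Rightarrow> 'a set) \<Rightarrow> 'a \<Rightarrow> 'a set" where
  "op_inverse A = (\<lambda>u. {x. u \<in> A x})"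

definition alpha_monotone :: "real \<Rightarrow> ('a::real_inner \<Rightarrow> 'a set) \<Rightarrow> bool" where
  "alpha_monotone \<alpha> A \<longleftrightarrow>
    (\<forall>(x, u) \<in> op_graph A. \<forall>(y, v) \<in> op_graph A. (x - y) \<bullet> (u - v) \<ge> \<alpha> * (norm (x - y))\<^sup>2)"

definition maximally_alpha_monotone :: "real \<Rightarrow> ('a::real_inner \<Rightarrow> 'a set) \<Rightarrow> bool" where
  "maximally_alpha_monotone \<alpha> A \<longleftrightarrow>
    alpha_monotone \<alpha> A \<and> \<not> (\<exists>A'. alpha_monotone \<alpha> A' \<and> op_graph A \<subset> op_graph A')"

definition resolvent :: "real \<Rightarrow> ('a::real_vector \<Rightarrow> 'a set) \<Rightarrow> 'a \<Rightarrow> 'a set" where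
  "resolvent \<gamma> A = op_inverse (op_add (\<lambda>x. {x}) (op_scale \<gamma> A))"

text \<open>The quotients are taken in the extended reals, where \<open>0 / 0 = 0\<close> and \<open>a / 0 = \<infinity>\<close> for
  \<open>a > 0\<close>. So a sequence that reaches its limit and stays there converges linearly, whereas one
  that hits \<open>l\<close> and leaves it again infinitely often does not. In particular the condition implies
  convergence to \<open>l\<close>.\<close>

definition converges_linearly :: "(nat \<Rightarrow> 'a::real_normed_vector) \<Rightarrow> 'a \<Rightarrow> bool" where
  "converges_linearly x l \<longleftrightarrow>
    limsup (\<lambda>k. ereal (norm (x (Suc k) - l)) / ereal (norm (x k - l))) < 1"

end

theory Submission
  imports Defs
begin

text \<open>Put \<open>C x = \<theta> A x + \<sigma>\<^sub>A (x - q)\<close> and \<open>D x = \<theta> B x + \<sigma>\<^sub>B (x - q)\<close>. Both are strongly monotone,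
  \<open>C\<close> is maximally so, \<open>D\<close> is Lipschitz with constant \<open>\<theta> \<kappa> + \<sigma>\<^sub>B\<close>, and the iteration is
  Tseng's forward-backward-forward method for \<open>0 \<in> C z + D z\<close>, whose solution is the resolvent
  of \<open>A + B\<close> at \<open>q\<close>. Strong monotonicity turns Tseng's Fejer estimate into a contraction
  of the distance to \<open>z\<close>. The resolvents exist by Minty's theorem, proved
  by minimising the Fitzpatrick function plus half the squared norm; the zero \<open>z\<close> is the
  fixed point of the forward-backward map with a small step.\<close>

section \<open>Minty's theorem by convex minimisation\<close>

text \<open>A closed convex set of pairs stands for the epigraph of a convex function f, so that no
  extended real values are needed. The function f(p) + |p|^2/2 has a minimiser by completeness, and
  the last inequality is the first-order optimality condition there.\<close>

lemma strongly_convex_minimiser: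
  fixes E :: "('b::{real_inner, complete_space} \<times> real) set"
  assumes "E \<noteq> {}" "closed E" "convex E"
    and lower: "\<And>p r. (p, r) \<in> E \<Longrightarrow> r + (norm p)\<^sup>2 / 2 \<ge> 0"
  obtains p0 r0 where "(p0, r0) \<in> E"
    "\<And>p r. (p, r) \<in> E \<Longrightarrow> r + p0 \<bullet> p \<ge> r0 + (norm p0)\<^sup>2"
proof -
  define g :: "'b \<times> real \<Rightarrow> real" where "g e = snd e + (norm (fst e))\<^sup>2 / 2" for e
  define m where "m = Inf (g ` E)"
  have bdd: "bdd_below (g ` E)"
    using lower by (intro bdd_belowI2[of _ 0]) (auto simp: g_def)
  have m_le: "m \<le> g e" if "e \<in> E" for e
    unfolding m_def using that bdd by (intro cInf_lower) auto
  have "\<exists>e\<in>E. g e < m + 1 / real (Suc n)" for n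
    using cInf_lessD[of "g ` E" "m + 1 / real (Suc n)"] \<open>E \<noteq> {}\<close> unfolding m_def by auto
  then obtain e where eE: "\<And>n. e n \<in> E" and eg: "\<And>n. g (e n) < m + 1 / real (Suc n)"
    by metis
  \<comment> \<open>By the parallelogram law, \<open>g\<close> at the midpoint lies |fst a - fst
    b|^2/8 below the mean of \<open>g a\<close> and \<open>g b\<close>, or further, yet not below
    \<open>m\<close>. So minimising sequences are Cauchy in the first component.\<close>
  have mid: "(norm (fst a - fst b))\<^sup>2 \<le> 4 * (g a + g b - 2 * m)" if "a \<in> E" "b \<in> E" for a b
  proof -
    have "(1/2) *\<^sub>R a + (1/2) *\<^sub>R b \<in> E"
      using that \<open>convex E\<close> by (intro convexD) auto
    from m_le[OF this] have "m \<le> (snd a + snd b) / 2 + (norm ((1/2) *\<^sub>R (fst a + fst b)))\<^sup>2 / 2"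
      by (simp add: g_def scaleR_add_right add_divide_distrib)
    then show ?thesis
      by (simp add: g_def power2_norm_eq_inner inner_add inner_diff inner_commute field_simps)
  qed
  have small: "(norm (fst (e i) - fst (e j)))\<^sup>2 \<le> 8 / real (Suc N)" if "i \<ge> N" "j \<ge> N" for i j N
  proof -
    have "g (e k) - m \<le> 1 / real (Suc N)" if "k \<ge> N" for k
    proof -
      have "1 / real (Suc k) \<le> 1 / real (Suc N)" using that by (intro divide_left_mono) auto
      then show ?thesis using eg[of k] by linarith
    qed
    from this[OF that(1)] this[OF that(2)] mid[OF eE eE, of i j] show ?thesis by argo
  qed
  have "Cauchy (\<lambda>n. fst (e n))"
  proof (rule metric_CauchyI)
    fix d :: real assume "d > 0"
    then obtain N where N: "1 / real (Suc N) < d\<^sup>2 / 8"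
      using nat_approx_posE[of "d\<^sup>2 / 8"] by auto
    have "dist (fst (e i)) (fst (e j)) < d" if "i \<ge> N" "j \<ge> N" for i j
    proof -
      have "(norm (fst (e i) - fst (e j)))\<^sup>2 < d\<^sup>2" using small[OF that] N by simp
      then show ?thesis using \<open>d > 0\<close> by (simp add: dist_norm power2_less_imp_less)
    qed
    then show "\<exists>M. \<forall>i\<ge>M. \<forall>j\<ge>M. dist (fst (e i)) (fst (e j)) < d" by blast
  qed
  then obtain p0 where p0: "(\<lambda>n. fst (e n)) \<longlonglongrightarrow> p0"
    using Cauchy_convergent_iff convergent_def by blast
  have "\<forall>\<^sub>F n in sequentially. m \<le> g (e n)"
    by (simp add: m_le eE)
  moreover have "\<forall>\<^sub>F n in sequentially. g (e n) \<le> m + 1 / real (Suc n)"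
    by (intro always_eventually allI less_imp_le eg)
  moreover have "(\<lambda>n. m + 1 / real (Suc n)) \<longlonglongrightarrow> m"
    using tendsto_add[OF tendsto_const LIMSEQ_inverse_real_of_nat, of m]
    by (simp add: inverse_eq_divide)
  ultimately have "(\<lambda>n. g (e n)) \<longlonglongrightarrow> m"
    by (rule tendsto_sandwich[OF _ _ tendsto_const])
  \<comment> \<open>\<open>mid\<close> says nothing about the second components. They converge
    because \<open>snd\<close> is \<open>g\<close> minus half the squared norm.\<close>
  then have "(\<lambda>n. g (e n) - (norm (fst (e n)))\<^sup>2 / 2) \<longlonglongrightarrow> m - (norm p0)\<^sup>2 / 2"
    using p0 by (intro tendsto_intros) auto
  then have r0: "(\<lambda>n. snd (e n)) \<longlonglongrightarrow> m - (norm p0)\<^sup>2 / 2"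
    by (simp add: g_def)
  define r0 where "r0 = m - (norm p0)\<^sup>2 / 2"
  have "(\<lambda>n. (fst (e n), snd (e n))) \<longlonglongrightarrow> (p0, r0)"
    using p0 r0 unfolding r0_def by (rule tendsto_Pair)
  then have in_E: "(p0, r0) \<in> E"
    using closed_sequentially[OF \<open>closed E\<close>, of e] eE by simp
  have "r + p0 \<bullet> p \<ge> r0 + (norm p0)\<^sup>2" if "(p, r) \<in> E" for p r
  proof -
    \<comment> \<open>Along the segment from \<open>(p0, r0)\<close> to \<open>(p, r)\<close>,
      \<open>g\<close> equals m + t (b + t c): \<open>b\<close> is the slope at the minimiser and
      must be nonnegative.\<close>
    define b where "b = r - r0 + p0 \<bullet> (p - p0)"
    define c where "c = (norm (p - p0))\<^sup>2 / 2"
    have pos: "b + t * c \<ge> 0" if t: "0 < t" "t < 1" for t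
    proof -
      have "(1 - t) *\<^sub>R (p0, r0) + t *\<^sub>R (p, r) \<in> E"
        using t in_E \<open>(p, r) \<in> E\<close> \<open>convex E\<close> by (intro convexD) auto
      from m_le[OF this]
      have "m \<le> (1 - t) * r0 + t * r + (norm ((1 - t) *\<^sub>R p0 + t *\<^sub>R p))\<^sup>2 / 2"
        by (simp add: g_def)
      also have "\<dots> = m + t * (b + t * c)"
        by (simp add: r0_def b_def c_def power2_norm_eq_inner inner_add inner_diff inner_commute
            algebra_simps) (simp add: field_simps)
      finally show ?thesis using t by (simp add: zero_le_mult_iff)
    qed
    have "((\<lambda>t. b + t * c) \<longlongrightarrow> b + 0 * c) (at_right 0)"
      by (intro tendsto_intros)
    moreover have "\<forall>\<^sub>F t in at_right (0::real). b + t * c \<ge> 0"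
      unfolding eventually_at_right_field using pos by (intro exI[of _ 1]) auto
    ultimately have "b \<ge> 0"
      using tendsto_lowerbound[of "\<lambda>t. b + t * c" "b + 0 * c" "at_right 0" 0] by simp
    then show ?thesis
      by (simp add: b_def inner_diff_right power2_norm_eq_inner)
  qed
  with in_E that show ?thesis by blast
qed

text \<open>The set \<open>E\<close> in the proof is the epigraph of the Fitzpatrick function of \<open>G\<close>.\<close>

lemma minty_zero:
  fixes G :: "('a::{real_inner, complete_space} \<times> 'a) set"
  assumes mono: "\<And>x u y v. (x, u) \<in> G \<Longrightarrow> (y, v) \<in> G \<Longrightarrow> (x - y) \<bullet> (u - v) \<ge> 0"
    and maximal: "\<And>x u. (\<And>y v. (y, v) \<in> G \<Longrightarrow> (x - y) \<bullet> (u - v) \<ge> 0) \<Longrightarrow> (x, u) \<in> G"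
  shows "\<exists>x. (x, - x) \<in> G"
proof -
  define E where
    "E = (\<Inter>(y, v)\<in>G. {e :: ('a \<times> 'a) \<times> real. (v, y) \<bullet> fst e - snd e \<le> y \<bullet> v})"
  have E_iff: "((x, u), r) \<in> E \<longleftrightarrow> (\<forall>(y, v)\<in>G. y \<bullet> u + x \<bullet> v - y \<bullet> v \<le> r)" for x u r
    unfolding E_def by (auto simp: inner_commute algebra_simps)
  have closedE: "closed E"
    unfolding E_def by (intro closed_INT ballI) (auto intro!: closed_Collect_le continuous_intros)
  have convexE: "convex E"
    unfolding E_def
  proof (intro convex_INT, clarify)
    fix y v :: 'a
    have "{e :: ('a \<times> 'a) \<times> real. (v, y) \<bullet> fst e - snd e \<le> y \<bullet> v} = {e. ((v, y), -1) \<bullet> e \<le> y \<bullet> v}"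
      by (simp add: inner_prod_def)
    then show "convex {e :: ('a \<times> 'a) \<times> real. (v, y) \<bullet> fst e - snd e \<le> y \<bullet> v}"
      by (simp only: convex_halfspace_le)
  qed
  have graph_E: "((x, u), x \<bullet> u) \<in> E" if "(x, u) \<in> G" for x u
    unfolding E_iff using mono[OF that] by (auto simp: inner_diff inner_commute algebra_simps)
  \<comment> \<open>An empty \<open>G\<close> is impossible: \<open>maximal\<close> would then apply
    vacuously and put every pair into \<open>G\<close>.\<close>
  have "E \<noteq> {}"
    using graph_E maximal by (metis empty_iff)
  \<comment> \<open>The Fitzpatrick function dominates the inner product: if r < x \<bullet> u, then
    \<open>(x, u)\<close> is monotonically related to all of \<open>G\<close>, hence lies in
    \<open>G\<close>, and its own inequality in \<open>E_iff\<close> gives x \<bullet> u \<le>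
    r.\<close>
  have E_ge: "x \<bullet> u \<le> r" if "((x, u), r) \<in> E" for x u r
  proof (rule ccontr)
    assume *: "\<not> x \<bullet> u \<le> r"
    have "(x, u) \<in> G"
    proof (rule maximal)
      fix y v assume "(y, v) \<in> G"
      then show "(x - y) \<bullet> (u - v) \<ge> 0"
        using that * by (force simp: E_iff inner_diff)
    qed
    with that * show False by (force simp: E_iff)
  qed
  have norm_sum: "(norm (x + u))\<^sup>2 / 2 = x \<bullet> u + (norm (x, u))\<^sup>2 / 2" for x u :: 'a
    by (simp add: power2_norm_eq_inner inner_add inner_commute field_simps)
  have lower: "r + (norm p)\<^sup>2 / 2 \<ge> 0" if "(p, r) \<in> E" for p r
  proof -
    obtain x u where "p = (x, u)" by force
    with E_ge that norm_sum[of x u] show ?thesis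
      using zero_le_power2[of "norm (x + u)"] by (smt (verit) divide_nonneg_pos)
  qed
  obtain p0 r0 where "(p0, r0) \<in> E"
    and "\<And>p r. (p, r) \<in> E \<Longrightarrow> r + p0 \<bullet> p \<ge> r0 + (norm p0)\<^sup>2"
    using strongly_convex_minimiser[OF \<open>E \<noteq> {}\<close> closedE convexE lower] by blast
  moreover obtain x0 u0 where "p0 = (x0, u0)" by force
  ultimately have min: "\<And>p r. (p, r) \<in> E \<Longrightarrow> r + (x0, u0) \<bullet> p \<ge> r0 + (norm (x0, u0))\<^sup>2"
    and "x0 \<bullet> u0 \<le> r0"
    using E_ge by auto
  \<comment> \<open>The optimality condition at the graph points singles out
    \<open>(- u0, - x0)\<close>. It is monotonically related to \<open>G\<close>, hence belongs to
    it; comparing it with itself then makes the left side 0 and forces x0 + u0 = 0.\<close>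
  have key: "(- u0 - y) \<bullet> (- x0 - v) \<ge> (norm (x0 + u0))\<^sup>2" if "(y, v) \<in> G" for y v
    using min[OF graph_E[OF that]] \<open>x0 \<bullet> u0 \<le> r0\<close>
    by (simp add: power2_norm_eq_inner inner_add inner_diff inner_commute field_simps)
  have "(- u0, - x0) \<in> G"
    using key by (intro maximal) (meson order_trans zero_le_power2)
  from key[OF this] have "x0 + u0 = 0" by simp
  then have "x0 = - u0" by (simp add: eq_neg_iff_add_eq_0)
  with \<open>(- u0, - x0) \<in> G\<close> show ?thesis by (intro exI[of _ "- u0"]) simp
qed

text \<open>Translating the second coordinates by \<open>w\<close> preserves both hypotheses and
  reduces the claim to \<open>minty_zero\<close>.\<close>

lemma minty:
  fixes G :: "('a::{real_inner, complete_space} \<times> 'a) set"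
  assumes mono: "\<And>x u y v. (x, u) \<in> G \<Longrightarrow> (y, v) \<in> G \<Longrightarrow> (x - y) \<bullet> (u - v) \<ge> 0"
    and maximal: "\<And>x u. (\<And>y v. (y, v) \<in> G \<Longrightarrow> (x - y) \<bullet> (u - v) \<ge> 0) \<Longrightarrow> (x, u) \<in> G"
  shows "\<exists>x. (x, w - x) \<in> G"
proof -
  have "\<exists>x. (x, - x) \<in> {(x, u). (x, u + w) \<in> G}"
  proof (rule minty_zero)
    fix x u y v assume "(x, u) \<in> {(x, u). (x, u + w) \<in> G}" "(y, v) \<in> {(x, u). (x, u + w) \<in> G}"
    then show "(x - y) \<bullet> (u - v) \<ge> 0" using mono[of x "u + w" y "v + w"] by simp
  next
    fix x u assume *: "\<And>y v. (y, v) \<in> {(x, u). (x, u + w) \<in> G} \<Longrightarrow> (x - y) \<bullet> (u - v) \<ge> 0"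
    have "(x, u + w) \<in> G"
    proof (rule maximal)
      fix y v assume "(y, v) \<in> G"
      then show "(x - y) \<bullet> (u + w - v) \<ge> 0" using *[of y "v - w"] by (simp add: algebra_simps)
    qed
    then show "(x, u) \<in> {(x, u). (x, u + w) \<in> G}" by simp
  qed
  then show ?thesis by simp
qed

section \<open>Resolvents of maximally \<alpha>-monotone operators\<close>

lemma alpha_monotone_iff:
  "alpha_monotone \<alpha> A \<longleftrightarrow>
    (\<forall>x u y v. u \<in> A x \<longrightarrow> v \<in> A y \<longrightarrow> (x - y) \<bullet> (u - v) \<ge> \<alpha> * (norm (x - y))\<^sup>2)"
  unfolding alpha_monotone_def op_graph_def by auto

text \<open>Otherwise adding \<open>(x, u)\<close> to the graph would give a proper
  \<alpha>-monotone extension. This is the pointwise form of maximality that \<open>minty\<close>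
  asks for.\<close>

lemma maximally_alpha_monotoneD:
  assumes "maximally_alpha_monotone \<alpha> A"
    and rel: "\<And>y v. v \<in> A y \<Longrightarrow> (x - y) \<bullet> (u - v) \<ge> \<alpha> * (norm (x - y))\<^sup>2"
  shows "u \<in> A x"
proof (rule ccontr)
  assume "u \<notin> A x"
  have mono: "(y - z) \<bullet> (v - w) \<ge> \<alpha> * (norm (y - z))\<^sup>2" if "v \<in> A y" "w \<in> A z" for y v z w
    using assms(1) that by (auto simp: maximally_alpha_monotone_def alpha_monotone_iff)
  define A' where "A' = A(x := insert u (A x))"
  have graph: "v \<in> A' y \<longleftrightarrow> v \<in> A y \<or> y = x \<and> v = u" for y v
    by (auto simp: A'_def)
  have rel': "(y - x) \<bullet> (v - u) \<ge> \<alpha> * (norm (y - x))\<^sup>2" if "v \<in> A y" for y v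
    using rel[OF that] by (simp add: norm_minus_commute inner_diff algebra_simps)
  have "alpha_monotone \<alpha> A'"
    unfolding alpha_monotone_iff graph using mono rel rel' by auto
  moreover have "op_graph A \<subset> op_graph A'"
    using \<open>u \<notin> A x\<close> unfolding op_graph_def by (auto simp: graph)
  ultimately show False
    using assms(1) unfolding maximally_alpha_monotone_def by blast
qed

lemma mem_resolvent_iff: "x \<in> resolvent \<gamma> A w \<longleftrightarrow> (\<exists>u\<in>A x. w = x + \<gamma> *\<^sub>R u)"
  unfolding resolvent_def op_inverse_def op_add_def op_scale_def
  by (auto simp: set_plus_def)

text \<open>Subtracting \<alpha> Id leaves a maximally monotone operator, to which
  \<open>minty\<close> applies after a positive rescaling. A negative \<alpha> is harmless as long
  as 1 + \<gamma> \<alpha> stays positive.\<close>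

lemma resolvent_nonempty:
  fixes A :: "'a::{real_inner, complete_space} \<Rightarrow> 'a set"
  assumes max: "maximally_alpha_monotone \<alpha> A" and "\<gamma> > 0" and pos: "1 + \<gamma> * \<alpha> > 0"
  shows "resolvent \<gamma> A w \<noteq> {}"
proof -
  text \<open>With \<open>v = \<gamma> / (1 + \<gamma> \<alpha>) \<cdot> (u - \<alpha> x)\<close>, the equation \<open>x + \<gamma> u = w\<close> becomes
    \<open>x + v = w / (1 + \<gamma> \<alpha>)\<close>.\<close>
  define c where "c = (1 + \<gamma> * \<alpha>) / \<gamma>"
  have "c > 0" using assms by (simp add: c_def)
  define G where "G = {(x, v). c *\<^sub>R v + \<alpha> *\<^sub>R x \<in> A x}"
  have shift: "(x - y) \<bullet> ((c *\<^sub>R v + \<alpha> *\<^sub>R x) - u) = c * ((x - y) \<bullet> (v - (1 / c) *\<^sub>R (u - \<alpha> *\<^sub>R y)))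
      + \<alpha> * (norm (x - y))\<^sup>2" for x y v u :: 'a
    using \<open>c > 0\<close> by (simp add: power2_norm_eq_inner inner_add inner_diff inner_commute algebra_simps)
  have "\<exists>x. (x, (1 / (1 + \<gamma> * \<alpha>)) *\<^sub>R w - x) \<in> G"
  proof (rule minty)
    fix x v y v' assume "(x, v) \<in> G" "(y, v') \<in> G"
    then have "\<alpha> * (norm (x - y))\<^sup>2 \<le> (x - y) \<bullet> ((c *\<^sub>R v + \<alpha> *\<^sub>R x) - (c *\<^sub>R v' + \<alpha> *\<^sub>R y))"
      using max unfolding G_def maximally_alpha_monotone_def alpha_monotone_iff by blast
    then have "0 \<le> c * ((x - y) \<bullet> (v - v'))"
      unfolding shift using \<open>c > 0\<close> by simp
    then show "0 \<le> (x - y) \<bullet> (v - v')" using \<open>c > 0\<close> by (simp add: zero_le_mult_iff)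
  next
    fix x v assume *: "\<And>y v'. (y, v') \<in> G \<Longrightarrow> (x - y) \<bullet> (v - v') \<ge> 0"
    have "c *\<^sub>R v + \<alpha> *\<^sub>R x \<in> A x"
    proof (rule maximally_alpha_monotoneD[OF max])
      fix y u assume "u \<in> A y"
      then have "(y, (1 / c) *\<^sub>R (u - \<alpha> *\<^sub>R y)) \<in> G"
        using \<open>c > 0\<close> by (simp add: G_def)
      from *[OF this] show "\<alpha> * (norm (x - y))\<^sup>2 \<le> (x - y) \<bullet> ((c *\<^sub>R v + \<alpha> *\<^sub>R x) - u)"
        unfolding shift using \<open>c > 0\<close> by simp
    qed
    then show "(x, v) \<in> G" by (simp add: G_def)
  qed
  then obtain x where x: "c *\<^sub>R ((1 / (1 + \<gamma> * \<alpha>)) *\<^sub>R w - x) + \<alpha> *\<^sub>R x \<in> A x"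
    by (auto simp: G_def)
  have "c * (1 / (1 + \<gamma> * \<alpha>)) = 1 / \<gamma>" "\<alpha> - c = - (1 / \<gamma>)"
    using pos \<open>\<gamma> > 0\<close> by (simp_all add: c_def field_simps)
  moreover have "c *\<^sub>R ((1 / (1 + \<gamma> * \<alpha>)) *\<^sub>R w - x) + \<alpha> *\<^sub>R x
      = (c * (1 / (1 + \<gamma> * \<alpha>))) *\<^sub>R w + (\<alpha> - c) *\<^sub>R x"
    by (simp add: scaleR_right_diff_distrib scaleR_left_diff_distrib)
  ultimately have "c *\<^sub>R ((1 / (1 + \<gamma> * \<alpha>)) *\<^sub>R w - x) + \<alpha> *\<^sub>R x = (1 / \<gamma>) *\<^sub>R (w - x)"
    by (simp only: scaleR_minus_left scaleR_right_diff_distrib add_uminus_conv_diff)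
  with x have "x \<in> resolvent \<gamma> A w"
    unfolding mem_resolvent_iff using \<open>\<gamma> > 0\<close> by (intro bexI) auto
  then show ?thesis by blast
qed

text \<open>Pairing w - w' with x - y, the operator part contributes a nonnegative term, and
  Cauchy-Schwarz finishes. With w = w' this gives uniqueness of resolvent points.\<close>

lemma resolvent_nonexpansive:
  assumes mono: "alpha_monotone \<mu> C" and "\<mu> \<ge> 0" "\<gamma> > 0"
    and x: "x \<in> resolvent \<gamma> C w" and y: "y \<in> resolvent \<gamma> C w'"
  shows "norm (x - y) \<le> norm (w - w')"
proof -
  obtain u v where u: "u \<in> C x" "w = x + \<gamma> *\<^sub>R u" and v: "v \<in> C y" "w' = y + \<gamma> *\<^sub>R v"
    using x y by (auto simp: mem_resolvent_iff)
  have "\<mu> * (norm (x - y))\<^sup>2 \<le> (x - y) \<bullet> (u - v)"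
    using mono u(1) v(1) unfolding alpha_monotone_iff by blast
  moreover have "0 \<le> \<mu> * (norm (x - y))\<^sup>2" using \<open>\<mu> \<ge> 0\<close> by simp
  ultimately have "0 \<le> (x - y) \<bullet> (u - v)" by linarith
  then have "0 \<le> \<gamma> * ((x - y) \<bullet> (u - v))" using \<open>\<gamma> > 0\<close> by simp
  then have "(norm (x - y))\<^sup>2 \<le> (x - y) \<bullet> (w - w')"
    unfolding u v by (simp add: power2_norm_eq_inner inner_add inner_diff algebra_simps)
  also have "\<dots> \<le> norm (x - y) * norm (w - w')" by (rule norm_cauchy_schwarz)
  finally show ?thesis
    by (cases "x = y") (auto simp: power2_eq_square)
qed

section \<open>A zero of the sum of two strongly monotone operators\<close>

text \<open>A fixed point of z \<mapsto> J (z - \<tau> D z) is a zero of C + D. Strong monotonicity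
  of \<open>D\<close> makes the forward step a contraction, the resolvent does not expand distances,
  and Banach's theorem applies.\<close>

lemma ex_zero_add_lipschitz:
  fixes C :: "'a::{real_inner, complete_space} \<Rightarrow> 'a set"
  assumes C: "maximally_alpha_monotone \<mu> C" "\<mu> > 0"
    and D: "alpha_monotone \<beta> (\<lambda>x. {D x})" "\<beta> > 0" "L-lipschitz_on UNIV D"
  shows "\<exists>z. - D z \<in> C z"
proof -
  text \<open>With this step \<open>\<tau>\<close>, the squared Lipschitz constant \<open>1 - 2 \<tau> \<beta> + \<tau>\<^sup>2 L\<^sup>2\<close> of the
    forward step is at most \<open>1 - \<tau> \<beta>\<close>, which lies in \<open>[0, 1)\<close>.\<close>
  define \<tau> where "\<tau> = \<beta> / (L\<^sup>2 + \<beta>\<^sup>2)"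
  have den: "L\<^sup>2 + \<beta>\<^sup>2 > 0" using D(2) by (simp add: add_nonneg_pos)
  then have "\<tau> > 0" using D(2) by (simp add: \<tau>_def)
  have tau: "\<tau> * (L\<^sup>2 + \<beta>\<^sup>2) = \<beta>" using den by (simp add: \<tau>_def)
  have "\<tau> * L\<^sup>2 \<le> \<tau> * (L\<^sup>2 + \<beta>\<^sup>2)"
    using \<open>\<tau> > 0\<close> by (intro mult_left_mono) auto
  then have "\<tau> * L\<^sup>2 \<le> \<beta>" by (simp only: tau)
  have "\<tau> * \<beta> \<le> 1" using den by (simp add: \<tau>_def power2_eq_square)
  have ne: "resolvent \<tau> C w \<noteq> {}" for w
    using C \<open>\<tau> > 0\<close> by (intro resolvent_nonempty) (auto intro: add_pos_pos)
  define J where "J w = (SOME p. p \<in> resolvent \<tau> C w)" for w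
  have J: "J w \<in> resolvent \<tau> C w" for w
    unfolding J_def using ne[of w] by (simp add: some_in_eq)
  define T where "T x = J (x - \<tau> *\<^sub>R D x)" for x
  have contr: "dist (T x) (T y) \<le> sqrt (1 - \<tau> * \<beta>) * dist x y" for x y
  proof -
    have mono: "\<beta> * (norm (x - y))\<^sup>2 \<le> (x - y) \<bullet> (D x - D y)"
      using D(1) by (auto simp: alpha_monotone_iff)
    have "(norm (D x - D y))\<^sup>2 \<le> (L * norm (x - y))\<^sup>2"
      using lipschitz_onD[OF D(3), of x y] by (intro power_mono) (auto simp: dist_norm)
    then have "\<tau>\<^sup>2 * (norm (D x - D y))\<^sup>2 \<le> \<tau>\<^sup>2 * (L * norm (x - y))\<^sup>2"
      by (intro mult_left_mono) auto
    also have "\<dots> = \<tau> * (\<tau> * L\<^sup>2) * (norm (x - y))\<^sup>2"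
      by (simp add: power2_eq_square)
    also have "\<dots> \<le> \<tau> * \<beta> * (norm (x - y))\<^sup>2"
      using \<open>\<tau> * L\<^sup>2 \<le> \<beta>\<close> \<open>\<tau> > 0\<close> by (intro mult_right_mono mult_left_mono) auto
    finally have lip: "\<tau>\<^sup>2 * (norm (D x - D y))\<^sup>2 \<le> \<tau> * \<beta> * (norm (x - y))\<^sup>2" .
    define w where "w = (x - \<tau> *\<^sub>R D x) - (y - \<tau> *\<^sub>R D y)"
    have "(norm w)\<^sup>2 = (norm (x - y))\<^sup>2 - 2 * (\<tau> * ((x - y) \<bullet> (D x - D y)))
        + \<tau>\<^sup>2 * (norm (D x - D y))\<^sup>2"
      unfolding w_def power2_norm_eq_inner power2_eq_square[of \<tau>]
      by (simp add: inner_diff inner_commute algebra_simps)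
    also have "\<dots> \<le> (norm (x - y))\<^sup>2 - 2 * (\<tau> * (\<beta> * (norm (x - y))\<^sup>2)) + \<tau> * \<beta> * (norm (x - y))\<^sup>2"
      using lip mult_left_mono[OF mono, of \<tau>] \<open>\<tau> > 0\<close> by linarith
    also have "\<dots> = (1 - \<tau> * \<beta>) * (norm (x - y))\<^sup>2" by (simp add: algebra_simps)
    finally have "norm w \<le> sqrt ((1 - \<tau> * \<beta>) * (norm (x - y))\<^sup>2)"
      by (rule real_le_rsqrt)
    moreover have "norm (T x - T y) \<le> norm w"
      unfolding T_def w_def using C \<open>\<tau> > 0\<close> J
      by (intro resolvent_nonexpansive[of \<mu> C \<tau>]) (auto simp: maximally_alpha_monotone_def)
    ultimately show ?thesis by (simp add: real_sqrt_mult dist_norm)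
  qed
  have "\<exists>!z. T z = z"
    using contr \<open>\<tau> * \<beta> \<le> 1\<close> \<open>\<tau> > 0\<close> D(2)
    by (intro banach_fix_type[of "sqrt (1 - \<tau> * \<beta>)"]) auto
  then obtain z where "T z = z" by blast
  then obtain u where "u \<in> C z" "z - \<tau> *\<^sub>R D z = z + \<tau> *\<^sub>R u"
    using J[of "z - \<tau> *\<^sub>R D z"] by (auto simp: T_def mem_resolvent_iff)
  then have "\<tau> *\<^sub>R (- D z) = \<tau> *\<^sub>R u"
    by (simp add: diff_conv_add_uminus del: add_uminus_conv_diff)
  then have "- D z = u" using \<open>\<tau> > 0\<close> by (subst (asm) real_vector.scale_cancel_left) auto
  with \<open>u \<in> C z\<close> show ?thesis by auto
qed

section \<open>Tseng's forward-backward-forward method and its linear rate\<close>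

text \<open>The second forward step replaces \<open>D x\<close> by \<open>D y\<close>, so that
  monotonicity of \<open>C\<close> and of \<open>D\<close> can both be used between \<open>y\<close>
  and \<open>z\<close>. The price is an error \<gamma> (D x - D y), which the Lipschitz bound
  absorbs into |x - y|^2.\<close>

lemma tseng_step:
  fixes C :: "'a::real_inner \<Rightarrow> 'a set"
  assumes C: "alpha_monotone \<mu> C"
    and D: "alpha_monotone \<beta> (\<lambda>x. {D x})" "L-lipschitz_on UNIV D"
    and "\<gamma> > 0"
    and z: "- D z \<in> C z"
    and y: "y \<in> resolvent \<gamma> C (x - \<gamma> *\<^sub>R D x)"
  shows "(norm (y - \<gamma> *\<^sub>R D y + \<gamma> *\<^sub>R D x - z))\<^sup>2 \<le> (norm (x - z))\<^sup>2
    - (1 - \<gamma>\<^sup>2 * L\<^sup>2) * (norm (x - y))\<^sup>2 - 2 * \<gamma> * (\<mu> + \<beta>) * (norm (y - z))\<^sup>2"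
proof -
  obtain u where u: "u \<in> C y" "x - \<gamma> *\<^sub>R D x = y + \<gamma> *\<^sub>R u"
    using y by (auto simp: mem_resolvent_iff)
  then have x: "x = y + \<gamma> *\<^sub>R u + \<gamma> *\<^sub>R D x" by (simp add: algebra_simps)
  have monoC: "\<mu> * (norm (y - z))\<^sup>2 \<le> (y - z) \<bullet> (u - (- D z))"
    using C u z unfolding alpha_monotone_iff by blast
  have monoD: "\<beta> * (norm (y - z))\<^sup>2 \<le> (y - z) \<bullet> (D y - D z)"
    using D by (auto simp: alpha_monotone_iff)
  have "(\<mu> + \<beta>) * (norm (y - z))\<^sup>2 \<le> (y - z) \<bullet> (u + D y)"
    using monoC monoD by (simp add: inner_diff inner_add algebra_simps)
  then have mono: "\<gamma> * ((\<mu> + \<beta>) * (norm (y - z))\<^sup>2) \<le> \<gamma> * ((y - z) \<bullet> (u + D y))"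
    using \<open>\<gamma> > 0\<close> by (intro mult_left_mono) auto
  have "(norm (D x - D y))\<^sup>2 \<le> (L * norm (x - y))\<^sup>2"
    using lipschitz_onD[OF D(2), of x y] by (intro power_mono) (auto simp: dist_norm)
  then have lip: "\<gamma>\<^sup>2 * (norm (D x - D y))\<^sup>2 \<le> \<gamma>\<^sup>2 * (L\<^sup>2 * (norm (x - y))\<^sup>2)"
    by (intro mult_left_mono) (auto simp: power_mult_distrib)
  \<comment> \<open>Here a + b is the old error and b + d the new one. The resolvent inclusion says
    that a - d is \<gamma> (u + D y), so the mixed term b \<bullet> (a - d) is the one that
    \<open>mono\<close> bounds.\<close>
  define a b d where "a = x - y" and "b = y - z" and "d = \<gamma> *\<^sub>R (D x - D y)"
  have "\<gamma> *\<^sub>R (u + D y) = a - d"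
    unfolding a_def d_def by (subst (1) x) (simp add: algebra_simps)
  then have "\<gamma> * ((y - z) \<bullet> (u + D y)) = b \<bullet> (a - d)"
    unfolding b_def by (metis inner_scaleR_right)
  moreover have "(norm (b + d))\<^sup>2 = (norm (a + b))\<^sup>2 - (norm a)\<^sup>2 + (norm d)\<^sup>2 - 2 * (b \<bullet> (a - d))"
    by (simp add: power2_norm_eq_inner inner_add inner_diff inner_commute algebra_simps)
  moreover have "b + d = y - \<gamma> *\<^sub>R D y + \<gamma> *\<^sub>R D x - z" "a + b = x - z"
    by (simp_all add: a_def b_def d_def algebra_simps)
  moreover have "(norm d)\<^sup>2 = \<gamma>\<^sup>2 * (norm (D x - D y))\<^sup>2"
    by (simp add: d_def power_mult_distrib)
  ultimately have "(norm (y - \<gamma> *\<^sub>R D y + \<gamma> *\<^sub>R D x - z))\<^sup>2 = (norm (x - z))\<^sup>2 - (norm (x - y))\<^sup>2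
      + \<gamma>\<^sup>2 * (norm (D x - D y))\<^sup>2 - 2 * (\<gamma> * ((y - z) \<bullet> (u + D y)))"
    by (simp only: a_def)
  also have "\<dots> \<le> (norm (x - z))\<^sup>2 - (norm (x - y))\<^sup>2
      + \<gamma>\<^sup>2 * (L\<^sup>2 * (norm (x - y))\<^sup>2) - 2 * (\<gamma> * ((\<mu> + \<beta>) * (norm (y - z))\<^sup>2))"
    using mono lip by linarith
  finally show ?thesis by (simp add: algebra_simps)
qed

text \<open>The two terms subtracted in \<open>tseng_step\<close> together control |x - z|^2, since
  |x - z|^2 \<le> 2 |x - y|^2 + 2 |y - z|^2. The factor \<open>c\<close> is fixed before
  \<open>x\<close> and \<open>y\<close>, hence uniform along the iteration.\<close>

lemma tseng_contraction:
  fixes C :: "'a::real_inner \<Rightarrow> 'a set"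
  assumes C: "alpha_monotone \<mu> C" "\<mu> > 0"
    and D: "alpha_monotone \<beta> (\<lambda>x. {D x})" "\<beta> > 0" "L-lipschitz_on UNIV D"
    and \<gamma>: "\<gamma> > 0" "\<gamma> * L < 1"
    and z: "- D z \<in> C z"
  obtains c where "0 \<le> c" "c < 1"
    "\<And>x y. y \<in> resolvent \<gamma> C (x - \<gamma> *\<^sub>R D x) \<Longrightarrow>
      norm (y - \<gamma> *\<^sub>R D y + \<gamma> *\<^sub>R D x - z) \<le> c * norm (x - z)"
proof -
  \<comment> \<open>The smaller of the two coefficients in \<open>tseng_step\<close>; the factor 2
    above turns it into \<delta> / 2.\<close>
  define \<delta> where "\<delta> = min (1 - \<gamma>\<^sup>2 * L\<^sup>2) (2 * \<gamma> * (\<mu> + \<beta>))"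
  have "L \<ge> 0" using D(3) by (rule lipschitz_on_nonneg)
  then have "(\<gamma> * L)\<^sup>2 < 1" using \<gamma> by (intro power_less_one_iff[THEN iffD2]) auto
  then have "\<delta> > 0" using C D \<gamma> by (simp add: \<delta>_def power_mult_distrib)
  have "\<delta> \<le> 1" by (simp add: \<delta>_def min.coboundedI1)
  show ?thesis
  proof (rule that[of "sqrt (1 - \<delta> / 2)"])
    show "0 \<le> sqrt (1 - \<delta> / 2)" "sqrt (1 - \<delta> / 2) < 1"
      using \<open>\<delta> > 0\<close> \<open>\<delta> \<le> 1\<close> by auto
    fix x y assume y: "y \<in> resolvent \<gamma> C (x - \<gamma> *\<^sub>R D x)"
    have par: "(norm (x - z))\<^sup>2 + (norm ((x - y) - (y - z)))\<^sup>2
        = 2 * (norm (x - y))\<^sup>2 + 2 * (norm (y - z))\<^sup>2"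
      by (simp add: power2_norm_eq_inner inner_diff inner_commute algebra_simps)
    then have "\<delta> / 2 * (norm (x - z))\<^sup>2 \<le> \<delta> / 2 * (2 * (norm (x - y))\<^sup>2 + 2 * (norm (y - z))\<^sup>2)"
      using \<open>\<delta> > 0\<close> by (intro mult_left_mono) (auto simp flip: par)
    also have "\<dots> = \<delta> * (norm (x - y))\<^sup>2 + \<delta> * (norm (y - z))\<^sup>2" by (simp add: algebra_simps)
    also have "\<dots> \<le> (1 - \<gamma>\<^sup>2 * L\<^sup>2) * (norm (x - y))\<^sup>2 + 2 * \<gamma> * (\<mu> + \<beta>) * (norm (y - z))\<^sup>2"
      by (intro add_mono mult_right_mono) (auto simp: \<delta>_def)
    finally have "(norm (y - \<gamma> *\<^sub>R D y + \<gamma> *\<^sub>R D x - z))\<^sup>2 \<le> (1 - \<delta> / 2) * (norm (x - z))\<^sup>2"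
      using tseng_step[OF C(1) D(1,3) \<gamma>(1) z y] by (simp add: algebra_simps)
    then have "norm (y - \<gamma> *\<^sub>R D y + \<gamma> *\<^sub>R D x - z) \<le> sqrt ((1 - \<delta> / 2) * (norm (x - z))\<^sup>2)"
      by (rule real_le_rsqrt)
    then show "norm (y - \<gamma> *\<^sub>R D y + \<gamma> *\<^sub>R D x - z) \<le> sqrt (1 - \<delta> / 2) * norm (x - z)"
      by (simp add: real_sqrt_mult)
  qed
qed

text \<open>At x k = l the step bound forces x (Suc k) = l, and the quotient is 0 / 0 = 0. The bound
  \<open>max c 0\<close> covers this case for negative \<open>c\<close> too.\<close>

lemma converges_linearlyI:
  assumes "c < 1" and step: "\<And>k. norm (x (Suc k) - l) \<le> c * norm (x k - l)"
  shows "converges_linearly x l"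
proof -
  have "ereal (norm (x (Suc k) - l)) / ereal (norm (x k - l)) \<le> ereal (max c 0)" for k
  proof (cases "x k = l")
    case True
    then show ?thesis using step[of k] by (simp add: zero_ereal_def flip: ereal_max)
  next
    case False
    then show ?thesis using step[of k] by (simp add: le_max_iff_disj pos_divide_le_eq)
  qed
  then have "limsup (\<lambda>k. ereal (norm (x (Suc k) - l)) / ereal (norm (x k - l))) \<le> ereal (max c 0)"
    by (intro Limsup_bounded always_eventually) auto
  also have "\<dots> < 1" using \<open>c < 1\<close> by simp
  finally show ?thesis unfolding converges_linearly_def .
qed

section \<open>Strengthened operators and their resolvents\<close>

text \<open>The operator \<theta> A + \<sigma> (Id - q). The added term raises the monotonicity
  constant by \<sigma>, and centring it at \<open>q\<close> lets zeros of a sum of two such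
  operators encode a resolvent at \<open>q\<close>.\<close>

definition strengthen :: "real \<Rightarrow> real \<Rightarrow> 'a \<Rightarrow> ('a::real_vector \<Rightarrow> 'a set) \<Rightarrow> 'a \<Rightarrow> 'a set" where
  "strengthen \<theta> \<sigma> q A x = (\<lambda>u. \<theta> *\<^sub>R u + \<sigma> *\<^sub>R (x - q)) ` A x"

lemma inner_strengthen:
  fixes x y u v q :: "'a::real_inner"
  shows "(x - y) \<bullet> ((\<theta> *\<^sub>R u + \<sigma> *\<^sub>R (x - q)) - (\<theta> *\<^sub>R v + \<sigma> *\<^sub>R (y - q)))
    = \<theta> * ((x - y) \<bullet> (u - v)) + \<sigma> * (norm (x - y))\<^sup>2"
  by (simp add: power2_norm_eq_inner inner_add inner_diff inner_commute algebra_simps)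

lemma alpha_monotone_strengthen:
  assumes "alpha_monotone \<alpha> A" "\<theta> \<ge> 0"
  shows "alpha_monotone (\<theta> * \<alpha> + \<sigma>) (strengthen \<theta> \<sigma> q A)"
  unfolding alpha_monotone_iff
proof (intro allI impI)
  fix x u' y v' assume "u' \<in> strengthen \<theta> \<sigma> q A x" "v' \<in> strengthen \<theta> \<sigma> q A y"
  then obtain u v where "u \<in> A x" "v \<in> A y" "u' = \<theta> *\<^sub>R u + \<sigma> *\<^sub>R (x - q)" "v' = \<theta> *\<^sub>R v + \<sigma> *\<^sub>R (y - q)"
    by (auto simp: strengthen_def)
  moreover from this have "\<theta> * (\<alpha> * (norm (x - y))\<^sup>2) \<le> \<theta> * ((x - y) \<bullet> (u - v))"
    using assms by (intro mult_left_mono) (auto simp: alpha_monotone_iff)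
  ultimately show "(\<theta> * \<alpha> + \<sigma>) * (norm (x - y))\<^sup>2 \<le> (x - y) \<bullet> (u' - v')"
    by (simp only: inner_strengthen) (simp add: algebra_simps)
qed

text \<open>On each fibre the passage from \<open>A\<close> is an invertible affine map, and
  \<open>inner_strengthen\<close> is an equality. So a new graph point of an extension pulls back to
  one related to all of \<open>A\<close>, where maximality of \<open>A\<close> applies.\<close>

lemma maximally_alpha_monotone_strengthen:
  assumes max: "maximally_alpha_monotone \<alpha> A" and "\<theta> > 0"
  shows "maximally_alpha_monotone (\<theta> * \<alpha> + \<sigma>) (strengthen \<theta> \<sigma> q A)"
  unfolding maximally_alpha_monotone_def
proof (intro conjI notI)
  show "alpha_monotone (\<theta> * \<alpha> + \<sigma>) (strengthen \<theta> \<sigma> q A)"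
    using assms by (intro alpha_monotone_strengthen) (auto simp: maximally_alpha_monotone_def)
  assume "\<exists>A'. alpha_monotone (\<theta> * \<alpha> + \<sigma>) A' \<and> op_graph (strengthen \<theta> \<sigma> q A) \<subset> op_graph A'"
  then obtain A' where mono: "alpha_monotone (\<theta> * \<alpha> + \<sigma>) A'"
    and sub: "op_graph (strengthen \<theta> \<sigma> q A) \<subset> op_graph A'" by blast
  obtain x u' where u': "u' \<in> A' x" "u' \<notin> strengthen \<theta> \<sigma> q A x"
    using sub by (auto simp: op_graph_def)
  define u where "u = (1 / \<theta>) *\<^sub>R (u' - \<sigma> *\<^sub>R (x - q))"
  have u'_eq: "u' = \<theta> *\<^sub>R u + \<sigma> *\<^sub>R (x - q)" using \<open>\<theta> > 0\<close> by (simp add: u_def)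
  have "u \<in> A x"
  proof (rule maximally_alpha_monotoneD[OF max])
    fix y v assume "v \<in> A y"
    then have "\<theta> *\<^sub>R v + \<sigma> *\<^sub>R (y - q) \<in> A' y"
      using sub by (auto simp: op_graph_def strengthen_def)
    with mono u' have "(\<theta> * \<alpha> + \<sigma>) * (norm (x - y))\<^sup>2
        \<le> (x - y) \<bullet> (u' - (\<theta> *\<^sub>R v + \<sigma> *\<^sub>R (y - q)))"
      unfolding alpha_monotone_iff by blast
    then have "\<theta> * (\<alpha> * (norm (x - y))\<^sup>2) \<le> \<theta> * ((x - y) \<bullet> (u - v))"
      unfolding u'_eq inner_strengthen by (simp add: algebra_simps)
    then show "\<alpha> * (norm (x - y))\<^sup>2 \<le> (x - y) \<bullet> (u - v)" using \<open>\<theta> > 0\<close> by simp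
  qed
  with u' u'_eq show False by (auto simp: strengthen_def)
qed

text \<open>Collecting the multiples of \<open>y\<close> in w = y + \<gamma> (\<theta> u + \<sigma>
  (y - q)) and dividing by 1 + \<gamma> \<sigma> explains the parameter and the argument of the
  resolvent in the iteration.\<close>

lemma resolvent_strengthen:
  assumes "1 + \<gamma> * \<sigma> > 0"
  shows "resolvent (\<gamma> * \<theta> / (1 + \<gamma> * \<sigma>)) A ((1 / (1 + \<gamma> * \<sigma>)) *\<^sub>R (w + (\<gamma> * \<sigma>) *\<^sub>R q))
    = resolvent \<gamma> (strengthen \<theta> \<sigma> q A) w"
proof -
  define s where "s = 1 + \<gamma> * \<sigma>"
  have "s > 0" using assms by (simp add: s_def)
  have "(1 / s) *\<^sub>R (w + (\<gamma> * \<sigma>) *\<^sub>R q) = y + (\<gamma> * \<theta> / s) *\<^sub>R u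
      \<longleftrightarrow> w = y + \<gamma> *\<^sub>R (\<theta> *\<^sub>R u + \<sigma> *\<^sub>R (y - q))" for y u
  proof -
    have "(1 / s) *\<^sub>R (w + (\<gamma> * \<sigma>) *\<^sub>R q) = y + (\<gamma> * \<theta> / s) *\<^sub>R u
      \<longleftrightarrow> s *\<^sub>R ((1 / s) *\<^sub>R (w + (\<gamma> * \<sigma>) *\<^sub>R q)) = s *\<^sub>R (y + (\<gamma> * \<theta> / s) *\<^sub>R u)"
      using \<open>s > 0\<close> by (subst real_vector.scale_cancel_left) auto
    also have "\<dots> \<longleftrightarrow> w + (\<gamma> * \<sigma>) *\<^sub>R q = s *\<^sub>R y + (\<gamma> * \<theta>) *\<^sub>R u"
      using \<open>s > 0\<close> by (simp add: scaleR_add_right)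
    also have "\<dots> \<longleftrightarrow> w = y + \<gamma> *\<^sub>R (\<theta> *\<^sub>R u + \<sigma> *\<^sub>R (y - q))"
      unfolding s_def by (auto simp: algebra_simps)
    finally show ?thesis .
  qed
  then show ?thesis
    unfolding s_def by (auto simp: mem_resolvent_iff strengthen_def)
qed

text \<open>After multiplication by \<sigma> + \<sigma>', the term in z - q is split between the two
  operators. The resolvent at \<open>q\<close> thus becomes a zero problem for the strengthened
  pair.\<close>

lemma mem_resolvent_sum_iff:
  assumes "\<sigma> + \<sigma>' > 0"
  shows "z \<in> resolvent (\<theta> / (\<sigma> + \<sigma>')) (op_add A (\<lambda>x. {B x})) q
    \<longleftrightarrow> - (\<theta> *\<^sub>R B z + \<sigma>' *\<^sub>R (z - q)) \<in> strengthen \<theta> \<sigma> q A z"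
proof -
  define s where "s = \<sigma> + \<sigma>'"
  have "s > 0" using assms by (simp add: s_def)
  have "q = z + (\<theta> / s) *\<^sub>R (u + B z)
      \<longleftrightarrow> - (\<theta> *\<^sub>R B z + \<sigma>' *\<^sub>R (z - q)) = \<theta> *\<^sub>R u + \<sigma> *\<^sub>R (z - q)" for u
  proof -
    have "q = z + (\<theta> / s) *\<^sub>R (u + B z) \<longleftrightarrow> s *\<^sub>R q = s *\<^sub>R (z + (\<theta> / s) *\<^sub>R (u + B z))"
      using \<open>s > 0\<close> by (subst real_vector.scale_cancel_left) auto
    also have "\<dots> \<longleftrightarrow> s *\<^sub>R q = s *\<^sub>R z + \<theta> *\<^sub>R (u + B z)"
      using \<open>s > 0\<close> by (simp add: scaleR_add_right)
    also have "\<dots> \<longleftrightarrow> - (\<theta> *\<^sub>R B z + \<sigma>' *\<^sub>R (z - q)) = \<theta> *\<^sub>R u + \<sigma> *\<^sub>R (z - q)"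
      unfolding s_def by (auto simp: algebra_simps eq_neg_iff_add_eq_0 neg_eq_iff_add_eq_0)
    finally show ?thesis .
  qed
  then show ?thesis
    unfolding s_def by (auto simp: mem_resolvent_iff strengthen_def op_add_def set_plus_def)
qed

section \<open>Linear convergence of the iteration to the resolvent of the sum\<close>

theorem theorem3:
  fixes A :: "'a::{real_inner, complete_space} \<Rightarrow> 'a set"
    and B :: "'a \<Rightarrow> 'a"
    and q x0 :: 'a
    and x y :: "nat \<Rightarrow> 'a"
    and \<alpha>\<^sub>A \<alpha>\<^sub>B \<kappa> \<theta> \<sigma>\<^sub>A \<sigma>\<^sub>B \<gamma> :: real
  assumes "maximally_alpha_monotone \<alpha>\<^sub>A A"
    and "alpha_monotone \<alpha>\<^sub>B (\<lambda>x. {B x})"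
    and "\<kappa> > 0"
    and "\<kappa>-lipschitz_on UNIV B"
    and "\<theta> > 0" and "\<sigma>\<^sub>A > 0" and "\<sigma>\<^sub>B > 0"
    and "\<theta> * \<alpha>\<^sub>A + \<sigma>\<^sub>A > 0"
    and "\<theta> * \<alpha>\<^sub>B + \<sigma>\<^sub>B > 0"
    and "\<gamma> \<in> {0<..<1 / (\<theta> * \<kappa> + \<sigma>\<^sub>B)}"
    and "x 0 = x0"
    and "\<And>k. y k = the_elem (resolvent (\<gamma> * \<theta> / (1 + \<gamma> * \<sigma>\<^sub>A)) A
           ((1 / (1 + \<gamma> * \<sigma>\<^sub>A)) *\<^sub>R
             ((1 - \<gamma> * \<sigma>\<^sub>B) *\<^sub>R x k - (\<gamma> * \<theta>) *\<^sub>R B (x k) + (\<gamma> * (\<sigma>\<^sub>A + \<sigma>\<^sub>B)) *\<^sub>R q)))"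
    and "\<And>k. x (Suc k) = (1 - \<gamma> * \<sigma>\<^sub>B) *\<^sub>R y k + (\<gamma> * \<sigma>\<^sub>B) *\<^sub>R x k
           - (\<gamma> * \<theta>) *\<^sub>R B (y k) + (\<gamma> * \<theta>) *\<^sub>R B (x k)"
  shows "(\<forall>k. resolvent (\<gamma> * \<theta> / (1 + \<gamma> * \<sigma>\<^sub>A)) A
           ((1 / (1 + \<gamma> * \<sigma>\<^sub>A)) *\<^sub>R
             ((1 - \<gamma> * \<sigma>\<^sub>B) *\<^sub>R x k - (\<gamma> * \<theta>) *\<^sub>R B (x k) + (\<gamma> * (\<sigma>\<^sub>A + \<sigma>\<^sub>B)) *\<^sub>R q)) = {y k})
    \<and> (\<exists>z. resolvent (\<theta> / (\<sigma>\<^sub>A + \<sigma>\<^sub>B)) (op_add A (\<lambda>x. {B x})) q = {z}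
         \<and> converges_linearly x z)"
proof -
  define C where "C = strengthen \<theta> \<sigma>\<^sub>A q A"
  define D where "D x = \<theta> *\<^sub>R B x + \<sigma>\<^sub>B *\<^sub>R (x - q)" for x
  define \<mu> where "\<mu> = \<theta> * \<alpha>\<^sub>A + \<sigma>\<^sub>A"
  define \<beta> where "\<beta> = \<theta> * \<alpha>\<^sub>B + \<sigma>\<^sub>B"
  \<comment> \<open>The Lipschitz constant of \<open>D\<close>; the bound on \<gamma> is exactly
    \<gamma> L < 1, as Tseng's method requires.\<close>
  define L where "L = \<theta> * \<kappa> + \<sigma>\<^sub>B"
  have "\<mu> > 0" "\<beta> > 0" using assms by (simp_all add: \<mu>_def \<beta>_def)
  have "L > 0" using assms by (simp add: L_def add_pos_pos)
  then have "\<gamma> > 0" "\<gamma> * L < 1" using assms(10) by (simp_all add: L_def pos_less_divide_eq)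
  have C: "maximally_alpha_monotone \<mu> C"
    unfolding C_def \<mu>_def using assms by (intro maximally_alpha_monotone_strengthen) auto
  then have monoC: "alpha_monotone \<mu> C" by (simp add: maximally_alpha_monotone_def)
  have "(\<lambda>x. {D x}) = strengthen \<theta> \<sigma>\<^sub>B q (\<lambda>x. {B x})"
    by (auto simp: strengthen_def D_def)
  then have D: "alpha_monotone \<beta> (\<lambda>x. {D x})"
    unfolding \<beta>_def using assms by (simp add: alpha_monotone_strengthen)
  have "L-lipschitz_on UNIV D"
  proof (rule lipschitz_onI)
    fix a b
    have "D a - D b = \<theta> *\<^sub>R (B a - B b) + \<sigma>\<^sub>B *\<^sub>R (a - b)"
      by (simp add: D_def algebra_simps)
    then have "norm (D a - D b) \<le> \<theta> * norm (B a - B b) + \<sigma>\<^sub>B * norm (a - b)"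
      using norm_triangle_ineq[of "\<theta> *\<^sub>R (B a - B b)" "\<sigma>\<^sub>B *\<^sub>R (a - b)"] assms by simp
    also have "\<theta> * norm (B a - B b) \<le> \<theta> * (\<kappa> * norm (a - b))"
      using lipschitz_onD[OF assms(4), of a b] assms by (intro mult_left_mono) (auto simp: dist_norm)
    finally show "dist (D a) (D b) \<le> L * dist a b"
      by (simp add: dist_norm L_def algebra_simps)
  qed (use \<open>L > 0\<close> in auto)
  note lipD = this
  define R where "R k = resolvent (\<gamma> * \<theta> / (1 + \<gamma> * \<sigma>\<^sub>A)) A ((1 / (1 + \<gamma> * \<sigma>\<^sub>A)) *\<^sub>R
    ((1 - \<gamma> * \<sigma>\<^sub>B) *\<^sub>R x k - (\<gamma> * \<theta>) *\<^sub>R B (x k) + (\<gamma> * (\<sigma>\<^sub>A + \<sigma>\<^sub>B)) *\<^sub>R q))" for k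
  have R: "R k = resolvent \<gamma> C (x k - \<gamma> *\<^sub>R D (x k))" for k
  proof -
    \<comment> \<open>The multiple of \<open>q\<close> splits:
      \<open>\<gamma> * \<sigma>\<^sub>B\<close> comes from the forward step in \<open>D\<close>,
      \<open>\<gamma> * \<sigma>\<^sub>A\<close> from \<open>resolvent_strengthen\<close>.\<close>
    have "(1 - \<gamma> * \<sigma>\<^sub>B) *\<^sub>R x k - (\<gamma> * \<theta>) *\<^sub>R B (x k) + (\<gamma> * (\<sigma>\<^sub>A + \<sigma>\<^sub>B)) *\<^sub>R q
        = (x k - \<gamma> *\<^sub>R D (x k)) + (\<gamma> * \<sigma>\<^sub>A) *\<^sub>R q"
      by (simp add: D_def algebra_simps)
    then show ?thesis
      unfolding R_def C_def using \<open>\<gamma> > 0\<close> assms(6) by (simp add: resolvent_strengthen add_pos_pos)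
  qed
  \<comment> \<open>\<open>the_elem\<close> is meaningful only on singletons, so existence and
    uniqueness come before any use of \<open>y k\<close>.\<close>
  have R_y: "R k = {y k}" for k
  proof -
    have "R k \<noteq> {}"
      unfolding R using C \<open>\<gamma> > 0\<close> \<open>\<mu> > 0\<close> by (intro resolvent_nonempty) (auto intro: add_pos_pos)
    moreover have "a = b" if "a \<in> R k" "b \<in> R k" for a b
      using resolvent_nonexpansive[OF monoC _ \<open>\<gamma> > 0\<close>, of a _ b] that \<open>\<mu> > 0\<close> unfolding R
      by fastforce
    ultimately obtain v where "R k = {v}" by blast
    moreover have "y k = the_elem (R k)" using assms(12) by (simp add: R_def)
    ultimately show ?thesis by simp
  qed
  obtain z where z: "- D z \<in> C z"
    using ex_zero_add_lipschitz[OF C \<open>\<mu> > 0\<close> D \<open>\<beta> > 0\<close> lipD] by blast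
  have res_iff: "v \<in> resolvent (\<theta> / (\<sigma>\<^sub>A + \<sigma>\<^sub>B)) (op_add A (\<lambda>x. {B x})) q \<longleftrightarrow> - D v \<in> C v" for v
    unfolding C_def D_def using assms(6,7) by (intro mem_resolvent_sum_iff) simp
  \<comment> \<open>In the sum of the two monotonicity inequalities the right sides cancel.\<close>
  have "v = z" if "- D v \<in> C v" for v
  proof -
    have "\<mu> * (norm (v - z))\<^sup>2 \<le> (v - z) \<bullet> (- D v - (- D z))"
      using monoC that z unfolding alpha_monotone_iff by blast
    moreover have "\<beta> * (norm (v - z))\<^sup>2 \<le> (v - z) \<bullet> (D v - D z)"
      using D by (auto simp: alpha_monotone_iff)
    ultimately have "(\<mu> + \<beta>) * (norm (v - z))\<^sup>2 \<le> 0"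
      by (simp add: inner_diff algebra_simps)
    then show ?thesis using \<open>\<mu> > 0\<close> \<open>\<beta> > 0\<close> by (simp add: mult_le_0_iff)
  qed
  with z have "resolvent (\<theta> / (\<sigma>\<^sub>A + \<sigma>\<^sub>B)) (op_add A (\<lambda>x. {B x})) q = {z}"
    using res_iff by blast
  moreover have "converges_linearly x z"
  proof -
    obtain c where "c < 1" and c: "\<And>x y. y \<in> resolvent \<gamma> C (x - \<gamma> *\<^sub>R D x) \<Longrightarrow>
        norm (y - \<gamma> *\<^sub>R D y + \<gamma> *\<^sub>R D x - z) \<le> c * norm (x - z)"
      using tseng_contraction[OF monoC \<open>\<mu> > 0\<close> D \<open>\<beta> > 0\<close> lipD \<open>\<gamma> > 0\<close> \<open>\<gamma> * L < 1\<close> z] by metis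
    \<comment> \<open>The terms in \<open>q\<close> cancel, so the second line of the iteration is
      Tseng's correction step for \<open>D\<close>.\<close>
    have "x (Suc k) = y k - \<gamma> *\<^sub>R D (y k) + \<gamma> *\<^sub>R D (x k)" for k
      unfolding assms(13) D_def by (simp add: algebra_simps)
    then show ?thesis
      using \<open>c < 1\<close> c R R_y by (intro converges_linearlyI[of c]) (metis insertI1)+
  qed
  ultimately show ?thesis
    using R_y unfolding R_def by blast
qed

end
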